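(* Let $\alpha\in(1,2)$. An $S\alpha S$ self-similar mixed moving average is a periodic (resp. cyclic) fractional stable motion if and only if the generating flow corresponding to its minimal representation is periodic (resp. cyclic).
   Context: Processes. Fix $\alpha\in(0,2)$, $H>0$ and put $\kappa=H-1/\alpha$. A standard Lebesgue space $(X,\mathcal X,\mu)$ is a measurable space in one-to-one, onto, bimeasurable correspondence with a Borel subset of a complete separable metric space, with a $\sigma$-finite measure $\mu$. A process $\{X_\alpha(t)\}_{t\in\mathbb R}$ has a mixed moving average representation with kernel $G$ on $(X,\mathcal X,\mu)$, written $X_\alpha(t)\stackrel{d}{=}\int_X\int_{\mathbb R}G_t(x,u)\,M_\alpha(dx,du)$, if $G:X\times\mathbb R\to\mathbb R$ is measurable, $G_t(x,u)=G(x,t+u)-G(x,u)$ is in $L^\alpha(X\times\mathbb R,\mu(dx)du)$ for every $t\in\mathbb R$, and for all $n$, $\theta_k,t_k\in\mathbb R$, $E\exp\{i\sum_{k=1}^n\theta_kX_\alpha(t_k)\}=\exp\{-\int_X\int_{\mathbb R}|\sum_{k=1}^n\theta_kG_{t_k}(x,u)|^\alpha\mu(dx)du\}$ (so $M_\alpha$ is a symmetric $\alpha$-stable, $S\alpha S$, random measure with control measure $\mu(dx)du$); $\stackrel{d}{=}$ is equality of finite-dimensional distributions. $X_\alpha$ is an $S\alpha S$ self-similar mixed moving average if it has such a representation and is $H$-self-similar: $\{X_\alpha(ct)\}\stackrel{d}{=}\{c^HX_\alpha(t)\}$ for every $c>0$. Flows. A measurable nonsingular flow $\{\psi_c\}_{c>0}$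 on $(X,\mathcal X,\mu)$ is a family of maps $\psi_c:X\to X$ with $\psi_{c_1c_2}(x)=\psi_{c_1}(\psi_{c_2}(x))$ for all $c_1,c_2>0$, $x\in X$, $\psi_1(x)=x$, $(c,x)\mapsto\psi_c(x)$ measurable, and $\mu(A)=0\Rightarrow\mu(\psi_c^{-1}(A))=0$. A cocycle with values in $\{-1,1\}$ is a measurable map $b_c(x)$ with $b_{c_1c_2}(x)=b_{c_1}(x)b_{c_2}(\psi_{c_1}(x))$; a semi-additive functional is a measurable real map $g_c(x)$ with $g_{c_1c_2}(x)=c_2^{-1}g_{c_1}(x)+g_{c_2}(\psi_{c_1}(x))$ (for all $c_1,c_2>0$, $x\in X$). The process $X_\alpha$ with kernel $G$ is generated by the flow $\{\psi_c\}$ (through $G$) if (i) for all $c>0$, $c^{-\kappa}G(x,cu)=b_c(x)\{\frac{d(\mu\circ\psi_c)}{d\mu}(x)\}^{1/\alpha}G(\psi_c(x),u+g_c(x))+j_c(x)$ for $\mu(dx)du$-a.e. $(x,u)$, for some cocycle $b_c$ with values in $\{-1,1\}$, some semi-additive functional $g_c$ and some function $j_c$; and (ii) the support condition holds: $\mathrm{supp}\{G_t,t\in\mathbb R\}=X\times\mathbb R$ a.e. $\mu(dx)du$, where $\mathrm{supp}\{G_t,t\in\mathbb R\}$ is the minimal (a.e.) set outside of which every $G_t$ vanishes a.e. Minimality. The representation is minimal if the support condition (ii) holds and every nonsingular map $\Phi:X\times\mathbb R\to X\times\mathbb R$ such that for each $t$, $G_t(\Phi(x,u))=k(x,u)G_t(x,u)$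 a.e. $\mu(dx)du$ with some $k(x,u)\ne0$, is the identity a.e. $\mu(dx)du$. Known facts: if $\alpha\in(1,2)$, every $S\alpha S$ self-similar mixed moving average has a minimal representation, and each minimal representation of it is generated by a unique flow. Point sets. For a flow $\{\psi_c\}$: $P=\{x:\exists\,p=p(x)\ne1,\ \psi_p(x)=x\}$ (periodic points, $p>0$), $F=\{x:\psi_c(x)=x\ \forall c>0\}$ (fixed points), $L=P\setminus F$ (cyclic points). The flow is periodic if $X=P$ $\mu$-a.e. and cyclic if $X=L$ $\mu$-a.e. Definition. Let $\alpha\in(1,2)$, take a minimal representation of $X_\alpha$ with kernel $G$ and its generating flow, and put $X_\alpha^S(t)=\int_S\int_{\mathbb R}G_t(x,u)M_\alpha(dx,du)$ for $S=P,L$ (the laws do not depend on the minimal representation used). $X_\alpha$ is called a periodic fractional stable motion if $X_\alpha\stackrel{d}{=}X_\alpha^P$, and a cyclic fractional stable motion if $X_\alpha\stackrel{d}{=}X_\alpha^L$. *)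

theory Defs
  imports "HOL-Probability.Probability"
begin

text \<open>The carrier of the complete separable metric space is a set of reals with an arbitrary
  metric \<open>d\<close> (not the usual one). This is no restriction: a separable metric space has at most
  continuum many points, so it is isometric to one carried by a set of reals.\<close>

definition standard_lebesgue :: "'x measure \<Rightarrow> bool" where
  "standard_lebesgue \<mu> \<longleftrightarrow> sigma_finite_measure \<mu> \<and>
    (\<exists>(Y :: real set) d B f g.
       Metric_space Y d \<and> Metric_space.mcomplete Y d \<and>
       separable_space (Metric_space.mtopology Y d) \<and>
       B \<in> sigma_sets Y {U. openin (Metric_space.mtopology Y d) U} \<and>
       (let N = restrict_space (sigma Y {U. openin (Metric_space.mtopology Y d) U}) B in
          f \<in> measurable \<mu> N \<and> g \<in> measurable N \<mu> \<and>
          (\<forall>x\<in>space \<mu>. g (f x) = x) \<and> (\<forall>y\<in>B. f (g y) = y)))"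

definition real_process :: "'w measure \<Rightarrow> (real \<Rightarrow> 'w \<Rightarrow> real) \<Rightarrow> bool" where
  "real_process M X \<longleftrightarrow> prob_space M \<and> (\<forall>t. X t \<in> borel_measurable M)"

definition eq_fdd ::
  "'w measure \<Rightarrow> (real \<Rightarrow> 'w \<Rightarrow> real) \<Rightarrow> 'v measure \<Rightarrow> (real \<Rightarrow> 'v \<Rightarrow> real) \<Rightarrow> bool" where
  "eq_fdd M X N Y \<longleftrightarrow> (\<forall>(n :: nat) (t :: nat \<Rightarrow> real).
     distr M (PiM {..<n} (\<lambda>_. borel)) (\<lambda>w. \<lambda>k\<in>{..<n}. X (t k) w) =
     distr N (PiM {..<n} (\<lambda>_. borel)) (\<lambda>w. \<lambda>k\<in>{..<n}. Y (t k) w))"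

definition self_similar :: "real \<Rightarrow> 'w measure \<Rightarrow> (real \<Rightarrow> 'w \<Rightarrow> real) \<Rightarrow> bool" where
  "self_similar H M X \<longleftrightarrow>
     (\<forall>c>0. eq_fdd M (\<lambda>t. X (c * t)) M (\<lambda>t w. c powr H * X t w))"

definition kernel_incr :: "('x \<times> real \<Rightarrow> real) \<Rightarrow> real \<Rightarrow> 'x \<times> real \<Rightarrow> real" where
  "kernel_incr G t = (\<lambda>(x, u). G (x, t + u) - G (x, u))"

text \<open>\<open>eq_stable_integral \<alpha> M X \<mu> G S\<close> says that \<open>X\<close> has the finite-dimensional distributions of
  \<open>\<integral>\<^bsub>S\<^esub>\<integral>\<^bsub>\<real>\<^esub> G\<^sub>t(x,u) M\<^sub>\<alpha>(dx,du)\<close>, where \<open>M\<^sub>\<alpha>\<close> is symmetric stable with control measure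
  \<open>\<mu>(dx)du\<close>. The set \<open>S\<close> need not be \<open>\<mu>\<close>-measurable, only measurable for the completion of
  \<open>\<mu>\<close>: by \<open>nn_integral_completion\<close> the integral is the one with respect to the completed
  measure.\<close>

definition eq_stable_integral ::
  "real \<Rightarrow> 'w measure \<Rightarrow> (real \<Rightarrow> 'w \<Rightarrow> real) \<Rightarrow> 'x measure \<Rightarrow> ('x \<times> real \<Rightarrow> real) \<Rightarrow> 'x set \<Rightarrow> bool"
  where
  "eq_stable_integral \<alpha> M X \<mu> G S \<longleftrightarrow>
     (\<forall>(n :: nat) (\<theta> :: nat \<Rightarrow> real) (t :: nat \<Rightarrow> real).
        (LINT w|M. exp (\<i> * complex_of_real (\<Sum>k<n. \<theta> k * X (t k) w))) =
        complex_of_real (exp (- enn2real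
          (\<integral>\<^sup>+z\<in>S \<times> UNIV. ennreal (\<bar>\<Sum>k<n. \<theta> k * kernel_incr G (t k) z\<bar> powr \<alpha>)
             \<partial>(\<mu> \<Otimes>\<^sub>M lborel)))))"

definition mma_rep ::
  "real \<Rightarrow> 'w measure \<Rightarrow> (real \<Rightarrow> 'w \<Rightarrow> real) \<Rightarrow> 'x measure \<Rightarrow> ('x \<times> real \<Rightarrow> real) \<Rightarrow> bool" where
  "mma_rep \<alpha> M X \<mu> G \<longleftrightarrow>
     standard_lebesgue \<mu> \<and>
     G \<in> borel_measurable (\<mu> \<Otimes>\<^sub>M lborel) \<and>
     (\<forall>t. (\<integral>\<^sup>+z. ennreal (\<bar>kernel_incr G t z\<bar> powr \<alpha>) \<partial>(\<mu> \<Otimes>\<^sub>M lborel)) < \<infinity>) \<and>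
     eq_stable_integral \<alpha> M X \<mu> G (space \<mu>)"

text \<open>The first argument fixes the type that carries the space \<open>X\<close> of the representation.\<close>

definition ss_mma :: "'x itself \<Rightarrow> real \<Rightarrow> real \<Rightarrow> 'w measure \<Rightarrow> (real \<Rightarrow> 'w \<Rightarrow> real) \<Rightarrow> bool" where
  "ss_mma _ \<alpha> H M X \<longleftrightarrow>
     real_process M X \<and> (\<exists>(\<mu> :: 'x measure) G. mma_rep \<alpha> M X \<mu> G) \<and> self_similar H M X"

definition vanishes_outside :: "'x measure \<Rightarrow> ('x \<times> real \<Rightarrow> real) \<Rightarrow> ('x \<times> real) set \<Rightarrow> bool" where
  "vanishes_outside \<mu> G A \<longleftrightarrow> A \<in> sets (\<mu> \<Otimes>\<^sub>M lborel) \<and>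
     (\<forall>t. AE z in \<mu> \<Otimes>\<^sub>M lborel. z \<notin> A \<longrightarrow> kernel_incr G t z = 0)"

definition is_support :: "'x measure \<Rightarrow> ('x \<times> real \<Rightarrow> real) \<Rightarrow> ('x \<times> real) set \<Rightarrow> bool" where
  "is_support \<mu> G A \<longleftrightarrow> vanishes_outside \<mu> G A \<and>
     (\<forall>B. vanishes_outside \<mu> G B \<longrightarrow> (AE z in \<mu> \<Otimes>\<^sub>M lborel. z \<in> A \<longrightarrow> z \<in> B))"

definition full_support :: "'x measure \<Rightarrow> ('x \<times> real \<Rightarrow> real) \<Rightarrow> bool" where
  "full_support \<mu> G \<longleftrightarrow> is_support \<mu> G (space \<mu> \<times> UNIV)"

definition nonsingular_map :: "'a measure \<Rightarrow> ('a \<Rightarrow> 'a) \<Rightarrow> bool" where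
  "nonsingular_map N \<Phi> \<longleftrightarrow> \<Phi> \<in> measurable N N \<and>
     (\<forall>A\<in>sets N. emeasure N A = 0 \<longrightarrow> emeasure N (\<Phi> -` A \<inter> space N) = 0)"

definition minimal_rep ::
  "real \<Rightarrow> 'w measure \<Rightarrow> (real \<Rightarrow> 'w \<Rightarrow> real) \<Rightarrow> 'x measure \<Rightarrow> ('x \<times> real \<Rightarrow> real) \<Rightarrow> bool" where
  "minimal_rep \<alpha> M X \<mu> G \<longleftrightarrow>
     mma_rep \<alpha> M X \<mu> G \<and> full_support \<mu> G \<and>
     (\<forall>\<Phi>. nonsingular_map (\<mu> \<Otimes>\<^sub>M lborel) \<Phi> \<and>
        (\<exists>k. (\<forall>z. k z \<noteq> 0) \<and>
           (\<forall>t. AE z in \<mu> \<Otimes>\<^sub>M lborel. kernel_incr G t (\<Phi> z) = k z * kernel_incr G t z))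
        \<longrightarrow> (AE z in \<mu> \<Otimes>\<^sub>M lborel. \<Phi> z = z))"

abbreviation positive_reals :: "real measure" where
  "positive_reals \<equiv> restrict_space borel {0<..}"

definition nonsingular_flow :: "'x measure \<Rightarrow> (real \<Rightarrow> 'x \<Rightarrow> 'x) \<Rightarrow> bool" where
  "nonsingular_flow \<mu> \<psi> \<longleftrightarrow>
     (\<lambda>(c, x). \<psi> c x) \<in> measurable (positive_reals \<Otimes>\<^sub>M \<mu>) \<mu> \<and>
     (\<forall>c>0. \<forall>d>0. \<forall>x\<in>space \<mu>. \<psi> (c * d) x = \<psi> c (\<psi> d x)) \<and>
     (\<forall>x\<in>space \<mu>. \<psi> 1 x = x) \<and>
     (\<forall>c>0. nonsingular_map \<mu> (\<psi> c))"

definition sign_cocycle :: "'x measure \<Rightarrow> (real \<Rightarrow> 'x \<Rightarrow> 'x) \<Rightarrow> (real \<Rightarrow> 'x \<Rightarrow> real) \<Rightarrow> bool" where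
  "sign_cocycle \<mu> \<psi> b \<longleftrightarrow>
     (\<lambda>(c, x). b c x) \<in> borel_measurable (positive_reals \<Otimes>\<^sub>M \<mu>) \<and>
     (\<forall>c>0. \<forall>x\<in>space \<mu>. b c x \<in> {-1, 1}) \<and>
     (\<forall>c>0. \<forall>d>0. \<forall>x\<in>space \<mu>. b (c * d) x = b c x * b d (\<psi> c x))"

definition semi_additive :: "'x measure \<Rightarrow> (real \<Rightarrow> 'x \<Rightarrow> 'x) \<Rightarrow> (real \<Rightarrow> 'x \<Rightarrow> real) \<Rightarrow> bool" where
  "semi_additive \<mu> \<psi> g \<longleftrightarrow>
     (\<lambda>(c, x). g c x) \<in> borel_measurable (positive_reals \<Otimes>\<^sub>M \<mu>) \<and>
     (\<forall>c>0. \<forall>d>0. \<forall>x\<in>space \<mu>. g (c * d) x = inverse d * g c x + g d (\<psi> c x))"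

text \<open>\<open>d(\<mu> \<circ> \<psi>\<^sub>c)/d\<mu>\<close>: the inverse of \<open>\<psi>\<^sub>c\<close> is \<open>\<psi>\<^bsub>1/c\<^esub>\<close>, so the measure
  \<open>A \<mapsto> \<mu>(\<psi>\<^sub>c(A))\<close> is the image of \<open>\<mu>\<close> under \<open>\<psi>\<^bsub>1/c\<^esub>\<close>.\<close>

definition flow_jacobian :: "'x measure \<Rightarrow> (real \<Rightarrow> 'x \<Rightarrow> 'x) \<Rightarrow> real \<Rightarrow> 'x \<Rightarrow> real" where
  "flow_jacobian \<mu> \<psi> c x = enn2real (RN_deriv \<mu> (distr \<mu> \<mu> (\<psi> (inverse c))) x)"

definition generated_by ::
  "real \<Rightarrow> real \<Rightarrow> 'x measure \<Rightarrow> ('x \<times> real \<Rightarrow> real) \<Rightarrow> (real \<Rightarrow> 'x \<Rightarrow> 'x) \<Rightarrow> bool" where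
  "generated_by \<alpha> H \<mu> G \<psi> \<longleftrightarrow>
     nonsingular_flow \<mu> \<psi> \<and>
     (\<exists>b g j. sign_cocycle \<mu> \<psi> b \<and> semi_additive \<mu> \<psi> g \<and>
        (\<forall>c>0. AE (x, u) in \<mu> \<Otimes>\<^sub>M lborel.
           c powr (- (H - 1 / \<alpha>)) * G (x, c * u) =
             b c x * flow_jacobian \<mu> \<psi> c x powr (1 / \<alpha>) * G (\<psi> c x, u + g c x) + j c x)) \<and>
     full_support \<mu> G"

definition periodic_points :: "'x measure \<Rightarrow> (real \<Rightarrow> 'x \<Rightarrow> 'x) \<Rightarrow> 'x set" where
  "periodic_points \<mu> \<psi> = {x \<in> space \<mu>. \<exists>p>0. p \<noteq> 1 \<and> \<psi> p x = x}"

definition fixed_points :: "'x measure \<Rightarrow> (real \<Rightarrow> 'x \<Rightarrow> 'x) \<Rightarrow> 'x set" where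
  "fixed_points \<mu> \<psi> = {x \<in> space \<mu>. \<forall>c>0. \<psi> c x = x}"

definition cyclic_points :: "'x measure \<Rightarrow> (real \<Rightarrow> 'x \<Rightarrow> 'x) \<Rightarrow> 'x set" where
  "cyclic_points \<mu> \<psi> = periodic_points \<mu> \<psi> - fixed_points \<mu> \<psi>"

definition periodic_flow :: "'x measure \<Rightarrow> (real \<Rightarrow> 'x \<Rightarrow> 'x) \<Rightarrow> bool" where
  "periodic_flow \<mu> \<psi> \<longleftrightarrow> (AE x in \<mu>. x \<in> periodic_points \<mu> \<psi>)"

definition cyclic_flow :: "'x measure \<Rightarrow> (real \<Rightarrow> 'x \<Rightarrow> 'x) \<Rightarrow> bool" where
  "cyclic_flow \<mu> \<psi> \<longleftrightarrow> (AE x in \<mu>. x \<in> cyclic_points \<mu> \<psi>)"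

definition minimal_rep_with_flow ::
  "real \<Rightarrow> real \<Rightarrow> 'w measure \<Rightarrow> (real \<Rightarrow> 'w \<Rightarrow> real) \<Rightarrow>
   'x measure \<Rightarrow> ('x \<times> real \<Rightarrow> real) \<Rightarrow> (real \<Rightarrow> 'x \<Rightarrow> 'x) \<Rightarrow> bool" where
  "minimal_rep_with_flow \<alpha> H M X \<mu> G \<psi> \<longleftrightarrow>
     minimal_rep \<alpha> M X \<mu> G \<and> generated_by \<alpha> H \<mu> G \<psi>"

text \<open>The definition of a periodic (cyclic) fractional stable motion starts by taking a minimal
  representation and its generating flow. The predicates \<open>\<dots>_fsm_via\<close> keep this choice as explicit
  arguments; the predicates \<open>periodic_fsm\<close> and \<open>cyclic_fsm\<close> on processes ask for some choice.\<close>

definition periodic_fsm_via ::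
  "real \<Rightarrow> real \<Rightarrow> 'w measure \<Rightarrow> (real \<Rightarrow> 'w \<Rightarrow> real) \<Rightarrow>
   'x measure \<Rightarrow> ('x \<times> real \<Rightarrow> real) \<Rightarrow> (real \<Rightarrow> 'x \<Rightarrow> 'x) \<Rightarrow> bool" where
  "periodic_fsm_via \<alpha> H M X \<mu> G \<psi> \<longleftrightarrow>
     minimal_rep_with_flow \<alpha> H M X \<mu> G \<psi> \<and>
     eq_stable_integral \<alpha> M X \<mu> G (periodic_points \<mu> \<psi>)"

definition cyclic_fsm_via ::
  "real \<Rightarrow> real \<Rightarrow> 'w measure \<Rightarrow> (real \<Rightarrow> 'w \<Rightarrow> real) \<Rightarrow>
   'x measure \<Rightarrow> ('x \<times> real \<Rightarrow> real) \<Rightarrow> (real \<Rightarrow> 'x \<Rightarrow> 'x) \<Rightarrow> bool" where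
  "cyclic_fsm_via \<alpha> H M X \<mu> G \<psi> \<longleftrightarrow>
     minimal_rep_with_flow \<alpha> H M X \<mu> G \<psi> \<and>
     eq_stable_integral \<alpha> M X \<mu> G (cyclic_points \<mu> \<psi>)"

definition periodic_fsm ::
  "'x itself \<Rightarrow> real \<Rightarrow> real \<Rightarrow> 'w measure \<Rightarrow> (real \<Rightarrow> 'w \<Rightarrow> real) \<Rightarrow> bool" where
  "periodic_fsm _ \<alpha> H M X \<longleftrightarrow>
     (\<exists>(\<mu> :: 'x measure) G \<psi>. periodic_fsm_via \<alpha> H M X \<mu> G \<psi>)"

definition cyclic_fsm ::
  "'x itself \<Rightarrow> real \<Rightarrow> real \<Rightarrow> 'w measure \<Rightarrow> (real \<Rightarrow> 'w \<Rightarrow> real) \<Rightarrow> bool" where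
  "cyclic_fsm _ \<alpha> H M X \<longleftrightarrow>
     (\<exists>(\<mu> :: 'x measure) G \<psi>. cyclic_fsm_via \<alpha> H M X \<mu> G \<psi>)"

end

theory Submission
  imports Defs
begin

text \<open>The Lebesgue integral of a nonnegative function is defined as a lower integral. If the laws
  of \<open>X\<close> and of its restriction to \<open>S\<close> agree, then the integrals of \<open>\<bar>G\<^sub>t\<bar>\<^sup>\<alpha>\<close> over
  \<open>S \<times> \<real>\<close> and over the whole space agree, so each \<open>G\<^sub>t\<close> vanishes a.e. outside \<open>S \<times> \<real>\<close>; the
  support condition then forces \<open>S\<close> to have full measure. Since lower integrals are attained by
  measurable minorants, no measurability of the set \<open>S\<close> of periodic or cyclic points is needed:
  \<open>S \<times> \<real>\<close> is replaced by its largest measurable subset modulo null sets.\<close>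

text \<open>The lower integral is a supremum over simple functions below \<open>f\<close>. Countably
  many of them already reach it, and their pointwise supremum is measurable and still below
  \<open>f\<close>.\<close>

lemma nn_integral_measurable_minorant:
  fixes f :: "'a \<Rightarrow> ennreal"
  obtains h where "h \<in> borel_measurable M" "\<And>z. h z \<le> f z" "(\<integral>\<^sup>+z. h z \<partial>M) = (\<integral>\<^sup>+z. f z \<partial>M)"
proof -
  let ?G = "{g. simple_function M g \<and> g \<le> f}"
  have "?G \<noteq> {}"
    by (auto intro!: exI[of _ "\<lambda>_. 0"] simp: le_fun_def)
  from ennreal_SUP_countable_SUP[OF this, of "integral\<^sup>S M"]
  obtain s :: "nat \<Rightarrow> ennreal" where s: "range s \<subseteq> integral\<^sup>S M ` ?G"
    "(SUP g\<in>?G. integral\<^sup>S M g) = Sup (range s)"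
    by blast
  then have "\<forall>i. \<exists>g\<in>?G. s i = integral\<^sup>S M g"
    by auto
  then obtain g where g: "\<And>i. simple_function M (g i)" "\<And>i. g i \<le> f" "\<And>i. s i = integral\<^sup>S M (g i)"
    by (metis mem_Collect_eq)
  define h where "h z = (SUP i. g i z)" for z
  have [measurable]: "g i \<in> borel_measurable M" for i
    using g(1) by (rule borel_measurable_simple_function)
  have meas: "h \<in> borel_measurable M"
    unfolding h_def by measurable
  have le: "h z \<le> f z" for z
    unfolding h_def using g(2) by (auto intro!: SUP_least simp: le_fun_def)
  have "(\<integral>\<^sup>+z. f z \<partial>M) = (SUP i. s i)"
    using s(2) by (simp add: nn_integral_def)
  also have "\<dots> \<le> (\<integral>\<^sup>+z. h z \<partial>M)"
  proof (rule SUP_least)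
    fix i
    have "s i = (\<integral>\<^sup>+z. g i z \<partial>M)"
      using g by (simp add: nn_integral_eq_simple_integral)
    also have "\<dots> \<le> (\<integral>\<^sup>+z. h z \<partial>M)"
      by (intro nn_integral_mono) (auto simp: h_def intro: SUP_upper)
    finally show "s i \<le> (\<integral>\<^sup>+z. h z \<partial>M)" .
  qed
  finally have "(\<integral>\<^sup>+z. h z \<partial>M) = (\<integral>\<^sup>+z. f z \<partial>M)"
    using nn_integral_mono[OF le] by (rule antisym[rotated])
  then show thesis
    using that meas le by blast
qed

text \<open>The difference \<open>f - h\<close> has integral zero. Finiteness matters here, since
  \<infinity> minus itself is \<infinity> in \<open>ennreal\<close>.\<close>

lemma nn_integral_eq_mono_AE:
  fixes h f :: "'a \<Rightarrow> ennreal"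
  assumes h: "h \<in> borel_measurable M" and f: "f \<in> borel_measurable M"
    and le: "\<And>z. z \<in> space M \<Longrightarrow> h z \<le> f z"
    and eq: "(\<integral>\<^sup>+z. h z \<partial>M) = (\<integral>\<^sup>+z. f z \<partial>M)" and fin: "(\<integral>\<^sup>+z. f z \<partial>M) < \<infinity>"
  shows "AE z in M. h z = f z"
proof -
  have "(\<integral>\<^sup>+z. f z - h z \<partial>M) = (\<integral>\<^sup>+z. f z \<partial>M) - (\<integral>\<^sup>+z. h z \<partial>M)"
    using assms by (intro nn_integral_diff) auto
  also have "\<dots> = 0"
    using eq fin by (simp add: less_top)
  finally have "AE z in M. f z - h z = 0"
    using h f by (subst (asm) nn_integral_0_iff_AE) auto
  then show ?thesis
    by (auto intro!: antisym le simp: ennreal_minus_eq_0)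
qed

text \<open>Let \<open>h\<close> be a measurable minorant of a positive weight on \<open>S\<close>
  with the same lower integral. It cannot be raised essentially on a measurable
  \<open>A \<subseteq> S\<close>, so it is already positive a.e. there, and \<open>B\<close> can be
  taken as the set where \<open>h\<close> is nonzero.\<close>

lemma (in sigma_finite_measure) obtain_measurable_kernel:
  obtains B where "B \<in> sets M" "B \<subseteq> S"
    "\<And>A. A \<in> sets M \<Longrightarrow> A \<subseteq> S \<Longrightarrow> AE z in M. z \<in> A \<longrightarrow> z \<in> B"
proof -
  \<comment> \<open>The weight makes the integrals finite without changing the null sets.\<close>
  obtain w :: "'a \<Rightarrow> ennreal" where w: "w \<in> borel_measurable M" "(\<integral>\<^sup>+z. w z \<partial>M) \<noteq> \<infinity>"
    "\<And>z. z \<in> space M \<Longrightarrow> 0 < w z \<and> w z < \<infinity>"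
    using Ex_finite_integrable_function by blast
  let ?f = "\<lambda>z. w z * indicator S z"
  obtain h where h: "h \<in> borel_measurable M" "\<And>z. h z \<le> ?f z" "(\<integral>\<^sup>+z. h z \<partial>M) = (\<integral>\<^sup>+z. ?f z \<partial>M)"
    using nn_integral_measurable_minorant[of M ?f] by blast
  have "(\<integral>\<^sup>+z. ?f z \<partial>M) \<le> (\<integral>\<^sup>+z. w z \<partial>M)"
    by (intro nn_integral_mono) (auto simp: indicator_def)
  with w(2) have fin: "(\<integral>\<^sup>+z. ?f z \<partial>M) < \<infinity>"
    by (auto simp: less_top top_unique)
  define B where "B = {z \<in> space M. h z \<noteq> 0}"
  have B: "B \<in> sets M"
    unfolding B_def using h(1) by measurable
  have BS: "B \<subseteq> S"
  proof
    fix z assume "z \<in> B"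
    then show "z \<in> S"
      using h(2)[of z] by (cases "z \<in> S") (auto simp: B_def)
  qed
  have "AE z in M. z \<in> A \<longrightarrow> z \<in> B" if A: "A \<in> sets M" "A \<subseteq> S" for A
  proof -
    \<comment> \<open>\<open>k\<close> raises \<open>h\<close> to the full weight on
      \<open>A\<close> and stays between \<open>h\<close> and \<open>?f\<close>. Equal integrals
      then force \<open>h = w > 0\<close> a.e. on \<open>A\<close>.\<close>
    define k where "k z = (if z \<in> A then w z else h z)" for z
    have k: "k \<in> borel_measurable M"
      unfolding k_def using h(1) w(1) A(1) by measurable
    have hk: "h z \<le> k z" for z
      using h(2)[of z] A(2) by (auto simp: k_def indicator_def split: if_splits)
    have kf: "k z \<le> ?f z" for z
      using h(2)[of z] A(2) by (auto simp: k_def indicator_def split: if_splits)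
    have "(\<integral>\<^sup>+z. h z \<partial>M) \<le> (\<integral>\<^sup>+z. k z \<partial>M)" "(\<integral>\<^sup>+z. k z \<partial>M) \<le> (\<integral>\<^sup>+z. ?f z \<partial>M)"
      using hk kf by (blast intro: nn_integral_mono)+
    then have k_int: "(\<integral>\<^sup>+z. k z \<partial>M) = (\<integral>\<^sup>+z. ?f z \<partial>M)"
      unfolding h(3) by (rule antisym[rotated])
    have "AE z in M. h z = k z"
      using h(1) k hk by (rule nn_integral_eq_mono_AE) (use h(3) k_int fin in simp_all)
    then show ?thesis
      using AE_space by eventually_elim (use w(3) in \<open>fastforce simp: B_def k_def\<close>)
  qed
  then show thesis
    using that B BS by blast
qed

lemma kernel_incr_measurable [measurable]:
  assumes [measurable]: "G \<in> borel_measurable (\<mu> \<Otimes>\<^sub>M lborel)"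
  shows "kernel_incr G t \<in> borel_measurable (\<mu> \<Otimes>\<^sub>M lborel)"
  unfolding kernel_incr_def by measurable

text \<open>Forward, Fubini leaves a condition independent of \<open>u\<close> that holds for a.e.
  \<open>u\<close>; it is true because Lebesgue measure is nonzero. Backward, a null set times the
  line is null, as 0 times \<infinity> is 0.\<close>

lemma AE_pair_lborel_fst_iff:
  assumes "sigma_finite_measure \<mu>"
  shows "(AE z in \<mu> \<Otimes>\<^sub>M (lborel :: real measure). P (fst z)) \<longleftrightarrow> (AE x in \<mu>. P x)"
proof
  interpret pair_sigma_finite \<mu> "lborel :: real measure"
    using assms by (simp add: pair_sigma_finite_def lborel.sigma_finite_measure_axioms)
  assume "AE z in \<mu> \<Otimes>\<^sub>M (lborel :: real measure). P (fst z)"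
  then have "AE x in \<mu>. AE u in (lborel :: real measure). P (fst (x, u))"
    by (rule AE_pair)
  then show "AE x in \<mu>. P x"
    by eventually_elim (simp add: eventually_const_iff ae_filter_eq_bot_iff)
next
  assume "AE x in \<mu>. P x"
  then obtain N where N: "{x \<in> space \<mu>. \<not> P x} \<subseteq> N" "N \<in> null_sets \<mu>"
    by (auto elim!: AE_E3 simp: null_sets_def)
  have "N \<times> UNIV \<in> null_sets (\<mu> \<Otimes>\<^sub>M (lborel :: real measure))"
    using N(2) by (auto simp: null_sets_def lborel.emeasure_pair_measure_Times)
  then show "AE z in \<mu> \<Otimes>\<^sub>M (lborel :: real measure). P (fst z)"
    by (rule AE_I') (use N(1) in \<open>auto simp: space_pair_measure\<close>)
qed

lemma eq_stable_integral_iff_AE: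
  fixes \<mu> :: "'x measure"
  assumes rep: "mma_rep \<alpha> M X \<mu> G" and full: "full_support \<mu> G"
  shows "eq_stable_integral \<alpha> M X \<mu> G S \<longleftrightarrow> (AE x in \<mu>. x \<in> S)"
proof
  have sf: "sigma_finite_measure \<mu>"
    and G [measurable]: "G \<in> borel_measurable (\<mu> \<Otimes>\<^sub>M lborel)"
    and fin: "\<And>t. (\<integral>\<^sup>+z. ennreal (\<bar>kernel_incr G t z\<bar> powr \<alpha>) \<partial>(\<mu> \<Otimes>\<^sub>M lborel)) < \<infinity>"
    and whole: "eq_stable_integral \<alpha> M X \<mu> G (space \<mu>)"
    using rep by (auto simp: mma_rep_def standard_lebesgue_def)
  interpret pair_sigma_finite \<mu> "lborel :: real measure"
    using sf by (simp add: pair_sigma_finite_def lborel.sigma_finite_measure_axioms)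
  {
    \<comment> \<open>Changing the domain of integration by a null set leaves every characteristic
      function unchanged.\<close>
    assume S: "AE x in \<mu>. x \<in> S"
    have "AE z in \<mu> \<Otimes>\<^sub>M (lborel :: real measure). fst z \<in> S"
      using S by (subst AE_pair_lborel_fst_iff[OF sf])
    then have "AE z in \<mu> \<Otimes>\<^sub>M (lborel :: real measure).
        indicator (S \<times> UNIV) z = (indicator (space \<mu> \<times> UNIV) z :: ennreal)"
      using AE_space by eventually_elim (auto simp: space_pair_measure indicator_def)
    then have "AE z in \<mu> \<Otimes>\<^sub>M (lborel :: real measure).
        f z * indicator (S \<times> UNIV) z = f z * indicator (space \<mu> \<times> UNIV) z"
      for f :: "'x \<times> real \<Rightarrow> ennreal"
      by eventually_elim simp
    note nn_integral_cong_AE[OF this]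
    then show "eq_stable_integral \<alpha> M X \<mu> G S"
      using whole by (simp add: eq_stable_integral_def)
  }
  assume S: "eq_stable_integral \<alpha> M X \<mu> G S"
  let ?N = "\<mu> \<Otimes>\<^sub>M (lborel :: real measure)"
  have sfN: "sigma_finite_measure ?N" ..
  \<comment> \<open>\<open>vanishes_outside\<close> asks for one measurable set serving all
    \<open>t\<close>, so \<open>B\<close> is fixed before \<open>t\<close>.\<close>
  obtain B where B: "B \<in> sets ?N" "B \<subseteq> S \<times> UNIV"
    and kernel: "\<And>A. A \<in> sets ?N \<Longrightarrow> A \<subseteq> S \<times> UNIV \<Longrightarrow> AE z in ?N. z \<in> A \<longrightarrow> z \<in> B"
    using sigma_finite_measure.obtain_measurable_kernel[OF sfN, of "S \<times> UNIV"] by blast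
  have "AE z in ?N. z \<notin> B \<longrightarrow> kernel_incr G t z = 0" for t
  proof -
    define f where "f z = ennreal (\<bar>kernel_incr G t z\<bar> powr \<alpha>)" for z
    let ?I = "\<lambda>T. \<integral>\<^sup>+z\<in>T \<times> UNIV. f z \<partial>?N"
    have f [measurable]: "f \<in> borel_measurable ?N"
      unfolding f_def by measurable
    \<comment> \<open>The case of a single time \<open>t\<close> with coefficient 1.\<close>
    have cf: "complex_of_real (exp (- enn2real (?I T))) =
        (LINT w|M. exp (\<i> * complex_of_real (X t w)))" if "eq_stable_integral \<alpha> M X \<mu> G T" for T
      using that[unfolded eq_stable_integral_def, THEN spec[of _ 1], THEN spec[of _ "\<lambda>_. 1"],
          THEN spec[of _ "\<lambda>_. t"]]
      by (simp add: f_def)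
    have "complex_of_real (exp (- enn2real (?I S))) = complex_of_real (exp (- enn2real (?I (space \<mu>))))"
      using cf[OF S] cf[OF whole] by simp
    then have eq: "enn2real (?I S) = enn2real (?I (space \<mu>))"
      by (simp only: of_real_eq_iff exp_inj_iff neg_equal_iff_equal)
    have I: "?I (space \<mu>) = (\<integral>\<^sup>+z. f z \<partial>?N)"
      by (intro nn_integral_cong) (auto simp: space_pair_measure)
    have finI: "(\<integral>\<^sup>+z. f z \<partial>?N) < \<infinity>"
      using fin unfolding f_def .
    \<comment> \<open>\<open>enn2real\<close> sends \<infinity> to 0, so both integrals must be
      finite before equality can be lifted back to \<open>ennreal\<close>.\<close>
    have "?I S \<le> (\<integral>\<^sup>+z. f z \<partial>?N)"
      by (intro nn_integral_mono) (auto simp: indicator_def)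
    then have "?I S < \<infinity>"
      using finI by (rule le_less_trans)
    with eq I finI have eqI: "?I S = (\<integral>\<^sup>+z. f z \<partial>?N)"
      by (metis ennreal_enn2real infinity_ennreal_def)
    obtain h where h [measurable]: "h \<in> borel_measurable ?N"
      and h_le: "\<And>z. h z \<le> f z * indicator (S \<times> UNIV) z" and h_int: "(\<integral>\<^sup>+z. h z \<partial>?N) = ?I S"
      using nn_integral_measurable_minorant[of ?N "\<lambda>z. f z * indicator (S \<times> UNIV) z"] by blast
    have h_le_f: "h z \<le> f z" for z
      using h_le[of z] by (cases "z \<in> S \<times> UNIV") auto
    have "AE z in ?N. h z = f z"
      using h_int eqI finI h_le_f by (intro nn_integral_eq_mono_AE) auto
    \<comment> \<open>The minorant \<open>h\<close> depends on \<open>t\<close>, but the set where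
      it is nonzero is a measurable subset of \<open>S \<times> UNIV\<close>, hence lies a.e. in
      \<open>B\<close>. Outside \<open>B\<close>, therefore, \<open>f = h = 0\<close> a.e.\<close>
    moreover have "AE z in ?N. z \<in> {z \<in> space ?N. h z \<noteq> 0} \<longrightarrow> z \<in> B"
    proof (rule kernel)
      show "{z \<in> space ?N. h z \<noteq> 0} \<subseteq> S \<times> UNIV"
      proof
        fix z assume "z \<in> {z \<in> space ?N. h z \<noteq> 0}"
        then show "z \<in> S \<times> UNIV"
          using h_le[of z] by (cases "z \<in> S \<times> UNIV") auto
      qed
    qed measurable
    ultimately show ?thesis
      using AE_space by eventually_elim (auto simp: f_def)
  qed
  then have "vanishes_outside \<mu> G B"
    using B(1) by (simp add: vanishes_outside_def)
  \<comment> \<open>Minimality of the support puts the whole space a.e. inside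
    \<open>B\<close>.\<close>
  then have "AE z in ?N. z \<in> space \<mu> \<times> UNIV \<longrightarrow> z \<in> B"
    using full by (auto simp: full_support_def is_support_def)
  then have "AE z in ?N. fst z \<in> S"
    using AE_space by eventually_elim (use B(2) in \<open>auto simp: space_pair_measure\<close>)
  then show "AE x in \<mu>. x \<in> S"
    by (subst (asm) AE_pair_lborel_fst_iff[OF sf])
qed

theorem proposition3p1:
  fixes \<alpha> H :: real and M :: "'w measure" and X :: "real \<Rightarrow> 'w \<Rightarrow> real"
  assumes "1 < \<alpha>" and "\<alpha> < 2" and "0 < H"
    and "ss_mma TYPE('x) \<alpha> H M X"
  shows "(\<forall>(\<mu> :: 'x measure) G \<psi>. minimal_rep_with_flow \<alpha> H M X \<mu> G \<psi> \<longrightarrow>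
            (periodic_fsm_via \<alpha> H M X \<mu> G \<psi> \<longleftrightarrow> periodic_flow \<mu> \<psi>) \<and>
            (cyclic_fsm_via \<alpha> H M X \<mu> G \<psi> \<longleftrightarrow> cyclic_flow \<mu> \<psi>)) \<and>
         (periodic_fsm TYPE('x) \<alpha> H M X \<longleftrightarrow>
            (\<exists>(\<mu> :: 'x measure) G \<psi>. minimal_rep_with_flow \<alpha> H M X \<mu> G \<psi> \<and> periodic_flow \<mu> \<psi>)) \<and>
         (cyclic_fsm TYPE('x) \<alpha> H M X \<longleftrightarrow>
            (\<exists>(\<mu> :: 'x measure) G \<psi>. minimal_rep_with_flow \<alpha> H M X \<mu> G \<psi> \<and> cyclic_flow \<mu> \<psi>))"
proof -
  \<comment> \<open>With \<open>S\<close> the periodic or the cyclic points, the right-hand side is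
    the definition of a periodic or cyclic flow.\<close>
  have "eq_stable_integral \<alpha> M X \<mu> G S \<longleftrightarrow> (AE x in \<mu>. x \<in> S)"
    if "minimal_rep_with_flow \<alpha> H M X \<mu> G \<psi>" for \<mu> :: "'x measure" and G \<psi> S
    using that by (intro eq_stable_integral_iff_AE)
      (auto simp: minimal_rep_with_flow_def minimal_rep_def)
  then have via: "periodic_fsm_via \<alpha> H M X \<mu> G \<psi> \<longleftrightarrow>
        minimal_rep_with_flow \<alpha> H M X \<mu> G \<psi> \<and> periodic_flow \<mu> \<psi>"
      "cyclic_fsm_via \<alpha> H M X \<mu> G \<psi> \<longleftrightarrow>
        minimal_rep_with_flow \<alpha> H M X \<mu> G \<psi> \<and> cyclic_flow \<mu> \<psi>"
    for \<mu> :: "'x measure" and G \<psi>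
    by (auto simp: periodic_fsm_via_def cyclic_fsm_via_def periodic_flow_def cyclic_flow_def)
  show ?thesis
    by (simp add: via periodic_fsm_def cyclic_fsm_def)
qed

end
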